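(* Let $\mathcal A=\{\mathbf a_1,\dots,\mathbf a_n\}\subset\mathbb{Z}^d$ be a configuration with $\mathbb{Z}\mathcal A=\mathbb{Z}^d$, whose vectors comprise the lattice points in a lattice polytope $R$, and such that the first row of the matrix $A=[\mathbf a_1\cdots\mathbf a_n]$ is $(1,\dots,1)$, so that $R$ is at height $1$. If $\mathbf a_n$ is a smooth vertex of $R$, then $P_{\{n\}}$ $(=P_{\{n\}}+I_{\mathcal A})$ is not an associated prime of the circuit ideal $I_{\mathcal C_{\mathcal A}}$.
   Context: Setting: $\mathbf k$ is an algebraically closed field and $\mathbf k[\mathbf x]=\mathbf k[x_1,\dots,x_n]$. The $d\times n$ integer matrix $A=[\mathbf a_1\cdots\mathbf a_n]$ has rank $d$, $\mathcal L_{\mathcal A}=\{\mathbf u\in\mathbb{Z}^n: A\mathbf u=\mathbf 0\}$, and $\mathcal L_{\mathcal A}\cap\mathbb{N}^n=\{\mathbf 0\}$ (both conditions are automatic under the hypotheses of the claim). For $\mathbf u\in\mathbb{Z}^n$: $\mathrm{supp}(\mathbf u)=\{i:u_i\ne0\}$, $u^+_i=\max(u_i,0)$, $u^-_i=\max(-u_i,0)$, so $\mathbf u=\mathbf u^+-\mathbf u^-$. Circuit: a non-zero vector $\mathbf c\in\mathcal L_{\mathcal A}$ whose entries have greatest common divisor one and such that no non-zero $\mathbf d\in\mathcal L_{\mathcal A}$ has $\mathrm{supp}(\mathbf d)\subsetneq\mathrm{supp}(\mathbf c)$. Circuit ideal: $I_{\mathcal C_{\mathcal A}}=\langle\mathbf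 x^{\mathbf c^+}-\mathbf x^{\mathbf c^-}:\mathbf c\text{ a circuit of }\mathcal A\rangle\subseteq\mathbf k[\mathbf x]$. Toric ideal: $I_{\mathcal A}=\langle\mathbf x^{\mathbf u^+}-\mathbf x^{\mathbf u^-}:\mathbf u\in\mathcal L_{\mathcal A}\rangle\subseteq\mathbf k[\mathbf x]$. For $\sigma\subseteq\{1,\dots,n\}$, $P_\sigma=\langle x_j:j\notin\sigma\rangle$; in particular $P_{\{n\}}=\langle x_j:j\neq n\rangle$. A prime ideal $P$ is an associated prime of an ideal $I\subseteq\mathbf k[\mathbf x]$ if $P=(I:f)$ for some $f\in\mathbf k[\mathbf x]$. Smoothness: a convex rational polyhedral cone $K\subset\mathbb{R}^t$ that does not contain a line is smooth if it is generated by primitive vectors that form part of a basis for $\mathbb{Z}^t$. For a face $F$ of a polytope $Q$, let $K_F$ denote the inner normal cone of $F$ (the cone of linear functionals whose minimum over $Q$ is attained at every point of $F$); $F$ is smooth if the restriction of $K_F$ to the linear span of $Q$ is smooth. Here $R=\{1\}\times R'$ with $R'\subset\mathbb{R}^{d-1}$ a full-dimensional lattice polytope, and a vertex $(1,v)$ of $R$ is smooth when the inner normal cone $\{c\in\mathbb{R}^{d-1}: c\cdot v\le c\cdot y\ \text{for all } y\in R'\}$ is smooth with respect to the lattice $\mathbb{Z}^{d-1}$.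
   Formalization: The formal theorem assumes d ≥ 2. For d = 1 the hypotheses force A = [1], n = 1, so the circuit ideal is 0 and P_{1} = 0 = (0:1) is an associated prime; the claim as stated fails in that one degenerate case. *)

theory Defs
  imports "HOL-Analysis.Analysis" "HOL-Library.Poly_Mapping" "HOL-Library.Set_Algebras"
    "HOL-Computational_Algebra.Polynomial"
begin

section \<open>Polynomials and ideals\<close>

text \<open>The finite type \<open>'n\<close> indexes the variables.\<close>

type_synonym ('n, 'k) mpolynomial = "('n \<Rightarrow>\<^sub>0 nat) \<Rightarrow>\<^sub>0 'k"

definition exponent :: "('n::finite \<Rightarrow> nat) \<Rightarrow> 'n \<Rightarrow>\<^sub>0 nat" where
  "exponent e = Abs_poly_mapping e"

definition monomial :: "('n::finite \<Rightarrow> nat) \<Rightarrow> ('n, 'k::field) mpolynomial" where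
  "monomial e = Poly_Mapping.single (exponent e) 1"

definition var :: "'n::finite \<Rightarrow> ('n, 'k::field) mpolynomial" where
  "var j = monomial (\<lambda>i. if i = j then 1 else 0)"

text \<open>Ideals are the submodules of the ring regarded as a module over itself.\<close>

lemma module_mult: "module ((*) :: 'a::comm_ring_1 \<Rightarrow> 'a \<Rightarrow> 'a)"
  by unfold_locales (simp_all add: algebra_simps)

definition is_ideal :: "'a::comm_ring_1 set \<Rightarrow> bool" where
  "is_ideal = module.subspace (*)"

definition ideal_gen :: "'a::comm_ring_1 set \<Rightarrow> 'a set" where
  "ideal_gen = module.span (*)"

definition prime_ideal :: "'a::comm_ring_1 set \<Rightarrow> bool" where
  "prime_ideal P \<longleftrightarrow>
     is_ideal P \<and> P \<noteq> UNIV \<and> (\<forall>f g. f * g \<in> P \<longrightarrow> f \<in> P \<or> g \<in> P)"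

definition colon :: "'a::comm_ring_1 set \<Rightarrow> 'a \<Rightarrow> 'a set" where
  "colon I f = {g. g * f \<in> I}"

definition associated_prime :: "'a::comm_ring_1 set \<Rightarrow> 'a set \<Rightarrow> bool" where
  "associated_prime P I \<longleftrightarrow> prime_ideal P \<and> (\<exists>f. P = colon I f)"


section \<open>Lattice ideals and circuits\<close>

definition kernel_lattice :: "int ^ 'n ^ 'd \<Rightarrow> (int ^ 'n) set" where
  "kernel_lattice A = {u. A *v u = 0}"

definition supp :: "int ^ 'n \<Rightarrow> 'n set" where
  "supp u = {i. u $ i \<noteq> 0}"

text \<open>Since \<^const>\<open>nat\<close> truncates, \<open>nat (u $ i)\<close> and \<open>nat (- (u $ i))\<close> are the entries
  \<open>max(u\<^sub>i, 0)\<close> and \<open>max(-u\<^sub>i, 0)\<close> of the positive and negative part of \<open>u\<close>.\<close>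

definition lattice_binomial :: "int ^ 'n \<Rightarrow> ('n::finite, 'k::field) mpolynomial" where
  "lattice_binomial u = monomial (\<lambda>i. nat (u $ i)) - monomial (\<lambda>i. nat (- (u $ i)))"

definition circuit :: "int ^ 'n ^ 'd \<Rightarrow> int ^ 'n \<Rightarrow> bool" where
  "circuit A c \<longleftrightarrow>
     c \<in> kernel_lattice A \<and> c \<noteq> 0 \<and> Gcd (range (($) c)) = 1 \<and>
     \<not> (\<exists>d \<in> kernel_lattice A. d \<noteq> 0 \<and> supp d \<subset> supp c)"

definition circuit_ideal :: "int ^ 'n ^ 'd \<Rightarrow> ('n::finite, 'k::field) mpolynomial set" where
  "circuit_ideal A = ideal_gen (lattice_binomial ` {c. circuit A c})"

definition toric_ideal :: "int ^ 'n ^ 'd \<Rightarrow> ('n::finite, 'k::field) mpolynomial set" where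
  "toric_ideal A = ideal_gen (lattice_binomial ` kernel_lattice A)"

definition monomial_prime :: "'n set \<Rightarrow> ('n::finite, 'k::field) mpolynomial set" where
  "monomial_prime \<sigma> = ideal_gen (var ` {j. j \<notin> \<sigma>})"


section \<open>Lattice polytopes and smooth vertices\<close>

lemma module_int_vec: "module ((*s) :: int \<Rightarrow> int ^ 'm \<Rightarrow> int ^ 'm)"
  by unfold_locales (simp_all add: vec_eq_iff algebra_simps)

definition int_span :: "(int ^ 'm) set \<Rightarrow> (int ^ 'm) set" where
  "int_span = module.span (*s)"

definition int_basis :: "(int ^ 'm) set \<Rightarrow> bool" where
  "int_basis W \<longleftrightarrow> \<not> module.dependent (*s) W \<and> int_span W = UNIV"

definition of_int_vec :: "int ^ 'm \<Rightarrow> real ^ 'm" where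
  "of_int_vec z = (\<chi> i. of_int (z $ i))"

definition lattice_polytope :: "(real ^ 'm) set \<Rightarrow> bool" where
  "lattice_polytope Q \<longleftrightarrow> (\<exists>V. finite V \<and> Q = convex hull (of_int_vec ` V))"

definition primitive :: "int ^ 'm \<Rightarrow> bool" where
  "primitive z \<longleftrightarrow> Gcd (range (($) z)) = 1"

text \<open>A cone generated by part of a lattice basis is automatically polyhedral, rational and
  contains no line, so these conditions are not listed separately.\<close>

definition smooth_cone :: "(real ^ 'm) set \<Rightarrow> bool" where
  "smooth_cone K \<longleftrightarrow>
     (\<exists>W B. int_basis W \<and> B \<subseteq> W \<and> (\<forall>b\<in>B. primitive b) \<and> K = convex_cone hull (of_int_vec ` B))"

definition inner_normal_cone :: "(real ^ 'm) set \<Rightarrow> real ^ 'm \<Rightarrow> (real ^ 'm) set" where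
  "inner_normal_cone Q v = {c. \<forall>y\<in>Q. c \<bullet> v \<le> c \<bullet> y}"

text \<open>For polytopes, vertices are the same as extreme points.\<close>

definition smooth_vertex :: "(real ^ 'm) set \<Rightarrow> real ^ 'm \<Rightarrow> bool" where
  "smooth_vertex Q v \<longleftrightarrow> v extreme_point_of Q \<and> smooth_cone (inner_normal_cone Q v)"

text \<open>The ambient space of dimension \<open>d\<close> is indexed by \<open>'m option\<close>, where \<open>'m\<close> has \<open>d - 1\<close>
  elements and \<open>None\<close> is the first coordinate; \<open>at_height_one y\<close> is the point \<open>(1, y)\<close>.
  As types are nonempty, \<open>d \<ge> 2\<close>.\<close>

definition at_height_one :: "'a::one ^ 'm \<Rightarrow> 'a ^ ('m option)" where
  "at_height_one y = (\<chi> i. case i of None \<Rightarrow> 1 | Some k \<Rightarrow> y $ k)"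

end

theory Submission
  imports Defs
begin

text \<open>Write \<open>x\<^sub>j\<close> for the variables, \<open>I\<^sub>A\<close> for the toric ideal, \<open>I\<^sub>C\<close> for the circuit ideal and \<open>P\<close> for the
  monomial prime of the vertex \<open>a\<^sub>n\<close>.

  Geometry. A smooth vertex looks like the corner of the standard orthant. Strict separation of
  the vertex from the remaining lattice generators shows that its normal cone is full-dimensional,
  so it is generated by a whole lattice basis \<open>W\<close> (\<open>smooth_vertex_normal_cone\<close>). The pairings of
  \<open>b \<in> W\<close> with \<open>a\<^sub>j - a\<^sub>n\<close> are then nonnegative integer coordinates of \<open>a\<^sub>j\<close>, and the point at
  lattice distance one along each coordinate axis belongs to the polytope, because an edge leaves
  the vertex in that direction and ends in a lattice point (\<open>smooth_vertex_edge_point\<close>). Hence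
  every unit vector is the coordinate vector of a column \<open>a\<^bsub>edge b\<^esub>\<close>. The locale
  \<open>unimodular_corner\<close> records exactly these facts.

  Algebra. Let \<open>\<lambda>\<^sub>j\<close> be the coordinate vector of \<open>a\<^sub>j\<close>, and \<open>s\<^sub>j\<close> the sum of its entries. Expressing
  any other column \<open>a\<^sub>j\<close> through the vertex and the points \<open>a\<^bsub>edge b\<^esub>\<close> gives a circuit, because
  these are linearly independent and \<open>a\<^sub>j\<close> enters with coefficient one. So for every \<open>j\<close> the circuit ideal
  contains \<open>x\<^sub>n\<^bsup>s\<^sub>j\<^esup> x\<^sub>j - x\<^sub>n m\<^sub>j\<close>, where \<open>m\<^sub>j\<close> is the monomial in the edge variables with exponents
  \<open>\<lambda>\<^sub>j\<close>. Multiplying these congruences turns a power of \<open>x\<^sub>n\<close> times any monomial into a monomial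
  that depends only on the \<open>A\<close>-degree, and the power of \<open>x\<^sub>n\<close> also depends only on the \<open>A\<close>-degree
  (\<open>corner_reduction\<close>, \<open>corner_reduction_cong\<close>). Consequently any element of the kernel of the map
  \<open>x\<^sup>u \<mapsto> t\<^bsup>Au\<^esup>\<close> into the group algebra of the lattice is carried into \<open>I\<^sub>C\<close> by a power of \<open>x\<^sub>n\<close>
  (\<open>toric_kernel_saturated\<close>).

  Conclusion. Suppose \<open>P = (I\<^sub>C : f)\<close>. For any edge variable \<open>x\<close> we have \<open>x f \<in> I\<^sub>C \<subseteq> I\<^sub>A\<close>, so
  \<open>x f\<close> is in the kernel of that map; as \<open>x\<close> is sent to a unit, \<open>f\<close> is in the kernel too. Hence
  \<open>x\<^sub>n\<^sup>k f \<in> I\<^sub>C\<close> for some \<open>k\<close>, which says that \<open>x\<^sub>n\<^sup>k \<in> P\<close>; this is absurd. The equation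
  \<open>P = P + I\<^sub>A\<close> expresses \<open>I\<^sub>A \<subseteq> P\<close>: by nonnegativity of the coordinates, a nonzero relation among
  the columns has both a positive and a negative entry away from \<open>n\<close>.\<close>

section \<open>Ideals\<close>

lemma ideal_gen_is_ideal: "is_ideal (ideal_gen S)"
  unfolding is_ideal_def ideal_gen_def by (rule module.subspace_span[OF module_mult])

lemma ideal_gen_superset: "S \<subseteq> ideal_gen S"
  unfolding ideal_gen_def by (rule module.span_superset[OF module_mult])

lemma ideal_gen_minimal: "S \<subseteq> I \<Longrightarrow> is_ideal I \<Longrightarrow> ideal_gen S \<subseteq> I"
  unfolding is_ideal_def ideal_gen_def by (rule module.span_minimal[OF module_mult])

lemma is_ideal_iff:
  "is_ideal I \<longleftrightarrow> 0 \<in> I \<and> (\<forall>f\<in>I. \<forall>g\<in>I. f + g \<in> I) \<and> (\<forall>r. \<forall>f\<in>I. r * f \<in> I)"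
  unfolding is_ideal_def module.subspace_def[OF module_mult] by blast

lemma is_ideal_zero: "is_ideal I \<Longrightarrow> 0 \<in> I"
  by (simp add: is_ideal_iff)

lemma is_ideal_add: "is_ideal I \<Longrightarrow> f \<in> I \<Longrightarrow> g \<in> I \<Longrightarrow> f + g \<in> I"
  by (simp add: is_ideal_iff)

lemma is_ideal_mult: "is_ideal I \<Longrightarrow> f \<in> I \<Longrightarrow> r * f \<in> I"
  by (simp add: is_ideal_iff)

lemma circuit_ideal_is_ideal: "is_ideal (circuit_ideal A)"
  unfolding circuit_ideal_def by (rule ideal_gen_is_ideal)

lemma toric_ideal_is_ideal: "is_ideal (toric_ideal A)"
  unfolding toric_ideal_def by (rule ideal_gen_is_ideal)

lemma monomial_prime_is_ideal: "is_ideal (monomial_prime \<sigma>)"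
  unfolding monomial_prime_def by (rule ideal_gen_is_ideal)

lemma is_ideal_diff: "is_ideal I \<Longrightarrow> f \<in> I \<Longrightarrow> g \<in> I \<Longrightarrow> f - g \<in> I"
  unfolding is_ideal_def by (rule module.subspace_diff[OF module_mult])

lemma is_ideal_sum: "is_ideal I \<Longrightarrow> (\<And>i. i \<in> J \<Longrightarrow> f i \<in> I) \<Longrightarrow> sum f J \<in> I"
  unfolding is_ideal_def by (rule module.subspace_sum[OF module_mult])

section \<open>Monomials and monomial primes\<close>

lemma lookup_exponent [simp]: "Poly_Mapping.lookup (exponent e) = e"
  by (simp add: exponent_def)

lemma exponent_eq_iff: "exponent e = u \<longleftrightarrow> e = Poly_Mapping.lookup u"
  by (metis lookup_exponent poly_mapping_eq_iff)

lemma var_eq_single: "var j = Poly_Mapping.single (Poly_Mapping.single j 1) 1"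
proof -
  have "exponent (\<lambda>i. if i = j then 1 else 0) = Poly_Mapping.single j 1"
    by (auto simp: exponent_eq_iff fun_eq_iff lookup_single when_def)
  then show ?thesis by (simp add: var_def monomial_def)
qed

lemma exponent_induct [case_names zero add]:
  fixes u :: "'n::finite \<Rightarrow>\<^sub>0 nat"
  assumes "P 0" and "\<And>j u. P u \<Longrightarrow> P (Poly_Mapping.single j 1 + u)"
  shows "P u"
proof (induction "\<Sum>j\<in>UNIV. Poly_Mapping.lookup u j" arbitrary: u)
  case 0
  then have "u = 0" by (auto intro!: poly_mapping_eqI)
  then show ?case using assms(1) by simp
next
  case (Suc k)
  then obtain j where j: "Poly_Mapping.lookup u j \<noteq> 0"
    by (metis nat.simps(3) sum.neutral)
  define w where "w = exponent ((Poly_Mapping.lookup u)(j := Poly_Mapping.lookup u j - 1))"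
  have u: "u = Poly_Mapping.single j 1 + w"
    using j by (intro poly_mapping_eqI) (simp add: w_def lookup_add lookup_single when_def)
  have "(\<Sum>i\<in>UNIV. Poly_Mapping.lookup u i) = 1 + (\<Sum>i\<in>UNIV. Poly_Mapping.lookup w i)"
    by (simp add: u lookup_add lookup_single sum.distrib when_def)
  then have "P w" using Suc by simp
  then show ?case using u assms(2) by simp
qed

lemma var_in_monomial_prime: "j \<notin> \<sigma> \<Longrightarrow> var j \<in> monomial_prime \<sigma>"
  unfolding monomial_prime_def by (rule subsetD[OF ideal_gen_superset]) simp

text \<open>The ideal is spanned by monomials, so membership can be read off from the support.\<close>

lemma monomial_prime_iff:
  fixes f :: "('n::finite, 'k::field) mpolynomial"
  shows "f \<in> monomial_prime \<sigma> \<longleftrightarrow> (\<forall>u\<in>Poly_Mapping.keys f. \<exists>j. j \<notin> \<sigma> \<and> Poly_Mapping.lookup u j \<noteq> 0)"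
proof
  assume f: "f \<in> monomial_prime \<sigma>"
  let ?S = "{f :: ('n, 'k) mpolynomial. \<forall>u\<in>Poly_Mapping.keys f. \<exists>j. j \<notin> \<sigma> \<and> Poly_Mapping.lookup u j \<noteq> 0}"
  have "is_ideal ?S"
    unfolding is_ideal_iff
  proof (intro conjI ballI allI)
    fix f g assume "f \<in> ?S" "g \<in> ?S"
    then show "f + g \<in> ?S" using keys_add[of f g] by blast
  next
    fix r f :: "('n, 'k) mpolynomial"
    assume f: "f \<in> ?S"
    show "r * f \<in> ?S"
    proof (clarify)
      fix u assume "u \<in> Poly_Mapping.keys (r * f)"
      then obtain a b where ab: "u = a + b" "b \<in> Poly_Mapping.keys f" using keys_mult[of r f] by blast
      then obtain j where "j \<notin> \<sigma>" "Poly_Mapping.lookup b j \<noteq> 0" using f by blast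
      then show "\<exists>j. j \<notin> \<sigma> \<and> Poly_Mapping.lookup u j \<noteq> 0" using ab by (auto simp: lookup_add)
    qed
  qed simp
  then have "monomial_prime \<sigma> \<subseteq> ?S"
    unfolding monomial_prime_def
    by (intro ideal_gen_minimal) (auto simp: var_eq_single)
  with f have "f \<in> ?S" by (rule rev_subsetD)
  then show "\<forall>u\<in>Poly_Mapping.keys f. \<exists>j. j \<notin> \<sigma> \<and> Poly_Mapping.lookup u j \<noteq> 0"
    by (rule CollectD)
next
  assume f: "\<forall>u\<in>Poly_Mapping.keys f. \<exists>j. j \<notin> \<sigma> \<and> Poly_Mapping.lookup u j \<noteq> 0"
  have "Poly_Mapping.single u (Poly_Mapping.lookup f u) \<in> monomial_prime \<sigma>"
    if key: "u \<in> Poly_Mapping.keys f" for u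
  proof -
    obtain j where j: "j \<notin> \<sigma>" "Poly_Mapping.lookup u j \<noteq> 0"
      using f key by blast
    define w where "w = exponent ((Poly_Mapping.lookup u)(j := Poly_Mapping.lookup u j - 1))"
    have u: "u = w + Poly_Mapping.single j 1"
      using j by (intro poly_mapping_eqI) (auto simp: w_def lookup_add lookup_single when_def)
    have "Poly_Mapping.single u (Poly_Mapping.lookup f u) =
        Poly_Mapping.single w (Poly_Mapping.lookup f u) * var j"
      by (subst u) (simp add: var_eq_single mult_single)
    then show ?thesis
      using j by (simp add: is_ideal_mult[OF monomial_prime_is_ideal] var_in_monomial_prime)
  qed
  moreover have "f = (\<Sum>u\<in>Poly_Mapping.keys f. Poly_Mapping.single u (Poly_Mapping.lookup f u))"
    by (intro poly_mapping_eqI)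
      (auto simp: lookup_sum lookup_single when_def in_keys_iff)
  ultimately show "f \<in> monomial_prime \<sigma>"
    unfolding monomial_prime_def by (metis (no_types, lifting) is_ideal_sum ideal_gen_is_ideal)
qed

lemma monomial_in_monomial_prime: "j \<notin> \<sigma> \<Longrightarrow> e j \<noteq> 0 \<Longrightarrow> monomial e \<in> monomial_prime \<sigma>"
  by (auto simp: monomial_prime_iff monomial_def)

section \<open>The multigrading and the toric ideal\<close>

text \<open>The linear extension of a map of exponents to (generalized) polynomials. For an additive map it is
  a homomorphism of monoid algebras.\<close>

definition push_forward :: "('a \<Rightarrow> 'b) \<Rightarrow> ('a \<Rightarrow>\<^sub>0 'k) \<Rightarrow> 'b \<Rightarrow>\<^sub>0 'k::comm_ring_1" where
  "push_forward h f = (\<Sum>u\<in>Poly_Mapping.keys f. Poly_Mapping.single (h u) (Poly_Mapping.lookup f u))"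

lemma push_forward_superset:
  assumes "finite T" "Poly_Mapping.keys f \<subseteq> T"
  shows "push_forward h f = (\<Sum>u\<in>T. Poly_Mapping.single (h u) (Poly_Mapping.lookup f u))"
  unfolding push_forward_def using assms
  by (intro sum.mono_neutral_left) (auto simp: in_keys_iff)

lemma push_forward_add: "push_forward h (f + g) = push_forward h f + push_forward h g"
  by (simp add: push_forward_superset[of "Poly_Mapping.keys f \<union> Poly_Mapping.keys g"] keys_add lookup_add single_add
      sum.distrib)

lemma push_forward_zero [simp]: "push_forward h 0 = 0"
  by (simp add: push_forward_def)

lemma push_forward_sum: "push_forward h (sum f T) = (\<Sum>i\<in>T. push_forward h (f i))"
  by (induction T rule: infinite_finite_induct) (simp_all add: push_forward_add)

lemma push_forward_single [simp]:
  "push_forward h (Poly_Mapping.single u r) = Poly_Mapping.single (h u) r"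
  by (simp add: push_forward_superset[of "{u}"])

lemma push_forward_diff: "push_forward h (f - g) = push_forward h f - push_forward h g"
  using push_forward_add[of h "f - g" g] by simp

lemma push_forward_id: "push_forward (\<lambda>u. u) f = f"
  by (intro poly_mapping_eqI)
    (auto simp: push_forward_def lookup_sum lookup_single when_def in_keys_iff)

lemma push_forward_comp: "push_forward h (push_forward g f) = push_forward (\<lambda>u. h (g u)) f"
  by (simp add: push_forward_def[of g] push_forward_def[of "\<lambda>u. h (g u)"] push_forward_sum)

lemma push_forward_mult:
  fixes h :: "'a::comm_monoid_add \<Rightarrow> 'b::comm_monoid_add"
  assumes "\<And>u w. h (u + w) = h u + h w"
  shows "push_forward h (f * g) = push_forward h f * push_forward h g"
proof -
  let ?m = "\<lambda>f u. Poly_Mapping.single u (Poly_Mapping.lookup f u)"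
  have "f * g = (\<Sum>u\<in>Poly_Mapping.keys f. ?m f u) * (\<Sum>w\<in>Poly_Mapping.keys g. ?m g w)"
    using push_forward_id[of f] push_forward_id[of g] by (simp add: push_forward_def)
  also have "\<dots> = (\<Sum>u\<in>Poly_Mapping.keys f. \<Sum>w\<in>Poly_Mapping.keys g.
      Poly_Mapping.single (u + w) (Poly_Mapping.lookup f u * Poly_Mapping.lookup g w))"
    by (simp add: sum_product mult_single)
  finally show ?thesis
    by (simp add: push_forward_sum assms)
      (simp add: push_forward_def sum_product mult_single)
qed

text \<open>The kernel of a push-forward is spanned by differences of monomials with the same image:
  subtracting from \<open>f\<close> its push-forward along a choice of representatives of the fibres of \<open>h\<close>
  changes nothing, since that push-forward factors through the one along \<open>h\<close>. The factor \<open>r\<close> makes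
  this usable for colon ideals.\<close>

lemma push_forward_eq_0_imp_multiple_in_ideal:
  fixes f r :: "'a::comm_monoid_add \<Rightarrow>\<^sub>0 'k::comm_ring_1"
  assumes I: "is_ideal I" and f: "push_forward h f = 0"
    and diffs: "\<And>u w. u \<in> Poly_Mapping.keys f \<Longrightarrow> h u = h w \<Longrightarrow>
      r * (Poly_Mapping.single u 1 - Poly_Mapping.single w 1) \<in> I"
  shows "r * f \<in> I"
proof -
  define rep where "rep = (\<lambda>u. inv h (h u))"
  have rep: "h u = h (rep u)" for u
    unfolding rep_def by (simp add: f_inv_into_f)
  have "push_forward rep f = 0"
    using push_forward_comp[of "inv h" h f] f by (simp add: rep_def)
  then have "f = push_forward (\<lambda>u. u) f - push_forward rep f"
    by (simp add: push_forward_id)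
  also have "\<dots> = (\<Sum>u\<in>Poly_Mapping.keys f. Poly_Mapping.single 0 (Poly_Mapping.lookup f u) *
      (Poly_Mapping.single u 1 - Poly_Mapping.single (rep u) 1))"
    by (simp add: push_forward_def sum_subtractf right_diff_distrib mult_single)
  finally have "r * f = (\<Sum>u\<in>Poly_Mapping.keys f. Poly_Mapping.single 0 (Poly_Mapping.lookup f u) *
      (r * (Poly_Mapping.single u 1 - Poly_Mapping.single (rep u) 1)))"
    by (metis (no_types, lifting) mult.left_commute sum_distrib_left sum.cong)
  then show ?thesis
    using I diffs rep by (auto intro!: is_ideal_sum simp: is_ideal_iff)
qed

definition multidegree :: "int ^ 'n ^ 'd \<Rightarrow> ('n::finite \<Rightarrow>\<^sub>0 nat) \<Rightarrow> int ^ 'd" where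
  "multidegree A u = A *v (\<chi> j. int (Poly_Mapping.lookup u j))"

lemma multidegree_add: "multidegree A (u + w) = multidegree A u + multidegree A w"
proof -
  have "(\<chi> j. int (Poly_Mapping.lookup (u + w) j)) = 
      (\<chi> j. int (Poly_Mapping.lookup u j)) + (\<chi> j. int (Poly_Mapping.lookup w j))"
    by (simp add: vec_eq_iff lookup_add)
  then show ?thesis by (simp add: multidegree_def matrix_vector_right_distrib)
qed

lemma multidegree_eq_iff:
  "multidegree A u = multidegree A w \<longleftrightarrow>
    (\<chi> j. int (Poly_Mapping.lookup u j) - int (Poly_Mapping.lookup w j)) \<in> kernel_lattice A"
proof -
  have "(\<chi> j. int (Poly_Mapping.lookup u j) - int (Poly_Mapping.lookup w j)) =
      (\<chi> j. int (Poly_Mapping.lookup u j)) - (\<chi> j. int (Poly_Mapping.lookup w j))"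
    by (simp add: vec_eq_iff)
  then show ?thesis
    by (simp add: multidegree_def kernel_lattice_def matrix_vector_mult_diff_distrib)
qed

lemma toric_ideal_push_forward:
  fixes f :: "('n::finite, 'k::field) mpolynomial"
  assumes "f \<in> toric_ideal A"
  shows "push_forward (multidegree A) f = 0"
proof -
  have "is_ideal {f :: ('n, 'k) mpolynomial. push_forward (multidegree A) f = 0}"
    by (auto simp: is_ideal_iff push_forward_add push_forward_mult multidegree_add)
  moreover have "push_forward (multidegree A) (lattice_binomial u :: ('n, 'k) mpolynomial) = 0"
    if "u \<in> kernel_lattice A" for u
  proof -
    have "(\<chi> j. int (nat (u $ j)) - int (nat (- u $ j))) = u"
      by (simp add: vec_eq_iff)
    then have "multidegree A (exponent (\<lambda>j. nat (u $ j))) =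
        multidegree A (exponent (\<lambda>j. nat (- (u $ j))))"
      using that by (simp add: multidegree_eq_iff)
    then show ?thesis
      by (simp add: lattice_binomial_def monomial_def push_forward_diff)
  qed
  ultimately have "toric_ideal A \<subseteq> {f :: ('n, 'k) mpolynomial. push_forward (multidegree A) f = 0}"
    unfolding toric_ideal_def by (intro ideal_gen_minimal) auto
  then show ?thesis using assms by blast
qed

text \<open>Every variable is sent to a unit of the group algebra of the lattice, and so can be cancelled.\<close>

lemma toric_ideal_monomial_cancel:
  fixes f :: "('n::finite, 'k::field) mpolynomial"
  assumes "var j * f \<in> toric_ideal A"
  shows "push_forward (multidegree A) f = 0"
proof -
  let ?d = "multidegree A (Poly_Mapping.single j 1)"
  have "Poly_Mapping.single ?d 1 * push_forward (multidegree A) f = 0"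
    using toric_ideal_push_forward[OF assms]
    by (simp add: push_forward_mult multidegree_add var_eq_single)
  then have "Poly_Mapping.single (- ?d) 1 *
      (Poly_Mapping.single ?d 1 * push_forward (multidegree A) f) = 0"
    by simp
  then show ?thesis by (simp add: mult.assoc[symmetric] mult_single)
qed

lemma circuit_binomial_in_circuit_ideal: "circuit A c \<Longrightarrow> lattice_binomial c \<in> circuit_ideal A"
  unfolding circuit_ideal_def by (rule subsetD[OF ideal_gen_superset]) simp

lemma circuit_ideal_subset_toric_ideal: "circuit_ideal A \<subseteq> toric_ideal A"
  unfolding circuit_ideal_def
proof (rule ideal_gen_minimal)
  show "is_ideal (toric_ideal A)" by (rule toric_ideal_is_ideal)
  show "lattice_binomial ` {c. circuit A c} \<subseteq> toric_ideal A"
    unfolding toric_ideal_def circuit_def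
    by (rule subset_trans[OF image_mono ideal_gen_superset]) auto
qed

section \<open>Circuit ideals at a unimodular corner\<close>

text \<open>A configuration whose points have nonnegative integer coordinates \<open>coord j\<close>, indexed by \<open>W\<close>, in
  which \<open>n\<close> is the origin and the points \<open>edge b\<close> are the unit vectors. The description of
  the kernel says that these are affine coordinates for the configuration.\<close>

locale unimodular_corner =
  fixes A :: "int ^ 'n::finite ^ 'd" and n :: 'n and W :: "'b set"
    and edge :: "'b \<Rightarrow> 'n" and coord :: "'n \<Rightarrow> 'b \<Rightarrow> nat"
  assumes finite_W: "finite W"
    and W_nonempty: "W \<noteq> {}"
    and kernel_iff: "u \<in> kernel_lattice A \<longleftrightarrow>
      (\<Sum>j\<in>UNIV. u $ j) = 0 \<and> (\<forall>b\<in>W. (\<Sum>j\<in>UNIV. u $ j * int (coord j b)) = 0)"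
    and coord_corner: "b \<in> W \<Longrightarrow> coord n b = 0"
    and coord_edge: "b \<in> W \<Longrightarrow> b' \<in> W \<Longrightarrow> coord (edge b) b' = (if b = b' then 1 else 0)"
    and coord_nonzero: "j \<noteq> n \<Longrightarrow> \<exists>b\<in>W. coord j b \<noteq> 0"
begin

lemma edge_neq_corner: "b \<in> W \<Longrightarrow> edge b \<noteq> n"
  using coord_corner[of b] coord_edge[of b b] by auto

definition coord_sum :: "'n \<Rightarrow> nat" where
  "coord_sum j = (\<Sum>b\<in>W. coord j b)"

definition edge_exponent :: "'n \<Rightarrow> 'n \<Rightarrow>\<^sub>0 nat" where
  "edge_exponent j = (\<Sum>b\<in>W. Poly_Mapping.single (edge b) (coord j b))"

lemma lookup_edge_exponent_eq_0: "i \<notin> edge ` W \<Longrightarrow> Poly_Mapping.lookup (edge_exponent j) i = 0"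
  by (auto simp: edge_exponent_def lookup_sum lookup_single when_def intro!: sum.neutral)

lemma sum_edge_exponent:
  "(\<Sum>i\<in>UNIV. int (Poly_Mapping.lookup (edge_exponent j) i) * g i) = (\<Sum>b\<in>W. int (coord j b) * g (edge b))"
proof -
  have "(\<Sum>i\<in>UNIV. int (Poly_Mapping.lookup (edge_exponent j) i) * g i)
      = (\<Sum>i\<in>UNIV. \<Sum>b\<in>W. if edge b = i then int (coord j b) * g i else 0)"
    by (simp add: edge_exponent_def lookup_sum lookup_single when_def sum_distrib_right
        if_distrib[of int] if_distrib[of "\<lambda>x. x * _"] cong: if_cong)
  also have "\<dots> = (\<Sum>b\<in>W. int (coord j b) * g (edge b))"
    by (subst sum.swap) simp
  finally show ?thesis .
qed

text \<open>The origin and the unit vectors are affinely independent: the coordinate \<open>b\<close> of a relation among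
  them is its entry at \<open>edge b\<close>, and the entry at \<open>n\<close> then vanishes because the entries sum to zero.\<close>

lemma kernel_supported_on_corner_eq_0:
  assumes "d \<in> kernel_lattice A" and supp: "\<And>i. i \<notin> insert n (edge ` W) \<Longrightarrow> d $ i = 0"
  shows "d = 0"
proof -
  have edge: "d $ edge b = 0" if b: "b \<in> W" for b
  proof -
    have "(\<Sum>i\<in>UNIV. d $ i * int (coord i b)) = (\<Sum>i\<in>UNIV. if i = edge b then d $ edge b else 0)"
    proof (rule sum.cong[OF refl])
      fix i
      show "d $ i * int (coord i b) = (if i = edge b then d $ edge b else 0)"
      proof (cases "i \<in> insert n (edge ` W)")
        case True
        then show ?thesis using b by (auto simp: coord_corner coord_edge edge_neq_corner split: if_split_asm)
      next
        case False
        then show ?thesis using supp[of i] b by auto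
      qed
    qed
    then show ?thesis using assms(1) b by (simp add: kernel_iff)
  qed
  then have others: "d $ i = 0" if "i \<noteq> n" for i using supp[of i] that by auto
  have "(\<Sum>i\<in>UNIV. d $ i) = (\<Sum>i\<in>UNIV. if i = n then d $ n else 0)"
    using others by (intro sum.cong) auto
  then have "d $ n = 0" using assms(1) by (simp add: kernel_iff)
  with others show ?thesis by (metis vec_eq_iff zero_index)
qed

text \<open>The relation \<open>a\<^sub>j + (s\<^sub>j - 1) a\<^sub>n = \<Sum>\<^sub>b coord j b a\<^bsub>edge b\<^esub>\<close>, where \<open>s\<^sub>j\<close> is \<open>coord_sum j\<close>.\<close>

definition corner_relation :: "'n \<Rightarrow> int ^ 'n" where
  "corner_relation j = (\<chi> i. (if i = j then 1 else 0) + (if i = n then int (coord_sum j) - 1 else 0)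
     - int (Poly_Mapping.lookup (edge_exponent j) i))"

lemma corner_relation_kernel: "corner_relation j \<in> kernel_lattice A"
proof -
  have "(\<Sum>i\<in>UNIV. corner_relation j $ i * g i) =
      g j + (int (coord_sum j) - 1) * g n - (\<Sum>b\<in>W. int (coord j b) * g (edge b))" for g
    by (simp add: corner_relation_def sum_edge_exponent left_diff_distrib distrib_right
        sum.distrib sum_subtractf if_distrib[of "\<lambda>x. x * _"] cong: if_cong)
  from this[of "\<lambda>_. 1"] this[of "\<lambda>i. int (coord i _)"] show ?thesis
    by (simp add: kernel_iff coord_sum_def coord_corner coord_edge finite_W
        if_distrib[of "\<lambda>x. _ * x"] if_distrib[of int] cong: if_cong)
qed

text \<open>A relation supported inside the support of the corner relation becomes, after subtracting a
  multiple of the latter to clear its entry at \<open>j\<close>, a relation among affinely independent points, hence zero; so it was a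
  multiple of the corner relation all along, and unless it is zero its support is not smaller.\<close>

lemma corner_relation_circuit:
  assumes j: "j \<notin> insert n (edge ` W)"
  shows "circuit A (corner_relation j)"
  unfolding circuit_def
proof (intro conjI notI)
  let ?c = "corner_relation j"
  have cj: "?c $ j = 1"
    using j lookup_edge_exponent_eq_0[of j j] by (simp add: corner_relation_def)
  have c0: "?c $ i = 0" if "i \<notin> insert j (insert n (edge ` W))" for i
    using that lookup_edge_exponent_eq_0[of i j] by (simp add: corner_relation_def)
  show "?c \<in> kernel_lattice A" by (rule corner_relation_kernel)
  show "False" if "?c = 0" using that cj by simp
  have "Gcd (range (($) ?c)) dvd 1" using cj by (metis Gcd_dvd rangeI)
  then show "Gcd (range (($) ?c)) = 1" by simp
  assume "\<exists>d\<in>kernel_lattice A. d \<noteq> 0 \<and> supp d \<subset> supp ?c"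
  then obtain d where d: "d \<in> kernel_lattice A" "d \<noteq> 0" "supp d \<subset> supp ?c" by blast
  have "d - d $ j *s ?c \<in> kernel_lattice A"
    using d(1) corner_relation_kernel[of j]
    by (simp add: kernel_iff left_diff_distrib sum_subtractf mult.assoc flip: sum_distrib_left)
  moreover have "(d - d $ j *s ?c) $ i = 0" if i: "i \<notin> insert n (edge ` W)" for i
  proof (cases "i = j")
    case False
    then have "?c $ i = 0" using c0 i by blast
    then show ?thesis using d(3) by (auto simp: supp_def)
  qed (simp add: cj)
  ultimately have "d - d $ j *s ?c = 0"
    by (rule kernel_supported_on_corner_eq_0)
  then obtain k where k: "d = k *s ?c" by auto
  then have "k \<noteq> 0" using d(2) by auto
  then have "supp d = supp ?c" by (simp add: supp_def k)
  then show False using d by blast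
qed

lemma coord_sum_pos: "j \<noteq> n \<Longrightarrow> 0 < coord_sum j"
  using coord_nonzero[of j] finite_W unfolding coord_sum_def by (metis gr0I sum_eq_0_iff)

text \<open>One more factor \<open>x\<^sub>n\<close> than in the circuit binomial gives the relation the same form for all \<open>j\<close>:
  for \<open>j = n\<close> and for the edge points the difference is zero.\<close>

lemma corner_binomial_in_circuit_ideal:
  "Poly_Mapping.single (Poly_Mapping.single n (coord_sum j) + Poly_Mapping.single j 1) 1
    - Poly_Mapping.single (Poly_Mapping.single n 1 + edge_exponent j) 1
    \<in> (circuit_ideal A :: ('n, 'k::field) mpolynomial set)"
proof (cases "j \<in> insert n (edge ` W)")
  case True
  have "Poly_Mapping.single n (coord_sum j) + Poly_Mapping.single j 1
      = Poly_Mapping.single n 1 + edge_exponent j"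
  proof (cases "j = n")
    case True
    then show ?thesis by (simp add: coord_sum_def edge_exponent_def coord_corner)
  next
    case False
    with True obtain b where b: "b \<in> W" "j = edge b" by blast
    have "edge_exponent j = (\<Sum>b'\<in>W. if b = b' then Poly_Mapping.single (edge b) 1 else 0)"
      unfolding edge_exponent_def by (intro sum.cong) (auto simp: b coord_edge)
    then have "edge_exponent j = Poly_Mapping.single j 1" using b finite_W by simp
    moreover have "coord_sum j = 1" using b finite_W by (simp add: coord_sum_def coord_edge)
    ultimately show ?thesis by simp
  qed
  then show ?thesis by (simp add: is_ideal_zero circuit_ideal_is_ideal)
next
  case False
  then have jn: "j \<noteq> n" by simp
  let ?c = "corner_relation j"
  have zero: "Poly_Mapping.lookup (edge_exponent j) j = 0" "Poly_Mapping.lookup (edge_exponent j) n = 0"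
    using False edge_neq_corner by (auto intro!: lookup_edge_exponent_eq_0)
  have pos: "exponent (\<lambda>i. nat (?c $ i)) =
      Poly_Mapping.single n (coord_sum j - 1) + Poly_Mapping.single j 1"
    unfolding exponent_eq_iff
  proof
    fix i
    show "nat (?c $ i) = Poly_Mapping.lookup
        (Poly_Mapping.single n (coord_sum j - 1) + Poly_Mapping.single j 1) i"
      using jn zero coord_sum_pos[OF jn]
      by (cases "i = j"; cases "i = n")
        (simp_all add: corner_relation_def lookup_add lookup_single_not_eq nat_diff_distrib)
  qed
  have neg: "exponent (\<lambda>i. nat (- (?c $ i))) = edge_exponent j"
    unfolding exponent_eq_iff
  proof
    fix i
    show "nat (- (?c $ i)) = Poly_Mapping.lookup (edge_exponent j) i"
      using jn zero coord_sum_pos[OF jn]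
      by (cases "i = j"; cases "i = n") (simp_all add: corner_relation_def)
  qed
  have "(lattice_binomial ?c :: ('n, 'k) mpolynomial) \<in> circuit_ideal A"
    by (rule circuit_binomial_in_circuit_ideal[OF corner_relation_circuit[OF False]])
  then have "var n * (lattice_binomial ?c :: ('n, 'k) mpolynomial) \<in> circuit_ideal A"
    by (rule is_ideal_mult[OF circuit_ideal_is_ideal])
  moreover have "Poly_Mapping.single n 1 + (Poly_Mapping.single n (coord_sum j - 1) + Poly_Mapping.single j 1)
      = Poly_Mapping.single n (coord_sum j) + Poly_Mapping.single j 1"
    using coord_sum_pos[OF jn] by (simp add: add.assoc[symmetric] single_add[symmetric])
  ultimately show ?thesis
    by (simp add: lattice_binomial_def monomial_def pos neg var_eq_single right_diff_distrib mult_single)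
qed

text \<open>The power of \<open>x\<^sub>n\<close> that a monomial needs in order to be congruent, modulo the circuit ideal, to a
  monomial in \<open>x\<^sub>n\<close> and the edge variables; the latter is given by the next definition.\<close>

definition corner_shift :: "('n \<Rightarrow>\<^sub>0 nat) \<Rightarrow> nat" where
  "corner_shift u = (\<Sum>j\<in>UNIV. Poly_Mapping.lookup u j * coord_sum j)"

definition corner_normal_form :: "('n \<Rightarrow>\<^sub>0 nat) \<Rightarrow> 'n \<Rightarrow>\<^sub>0 nat" where
  "corner_normal_form u = Poly_Mapping.single n (\<Sum>j\<in>UNIV. Poly_Mapping.lookup u j)
     + (\<Sum>b\<in>W. Poly_Mapping.single (edge b) (\<Sum>j\<in>UNIV. Poly_Mapping.lookup u j * coord j b))"

lemma corner_shift_add: "corner_shift (u + w) = corner_shift u + corner_shift w"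
  by (simp add: corner_shift_def lookup_add distrib_right sum.distrib)

lemma corner_shift_var: "corner_shift (Poly_Mapping.single j 1) = coord_sum j"
  by (simp add: corner_shift_def lookup_single when_def if_distrib[of "\<lambda>x. x * _"] cong: if_cong)

lemma corner_normal_form_add:
  "corner_normal_form (u + w) = corner_normal_form u + corner_normal_form w"
proof -
  have "Poly_Mapping.single n (\<Sum>j\<in>UNIV. Poly_Mapping.lookup (u + w) j)
    = Poly_Mapping.single n (\<Sum>j\<in>UNIV. Poly_Mapping.lookup u j)
    + Poly_Mapping.single n (\<Sum>j\<in>UNIV. Poly_Mapping.lookup w j)"
    by (simp add: lookup_add sum.distrib single_add)
  moreover have "(\<Sum>b\<in>W. Poly_Mapping.single (edge b) (\<Sum>j\<in>UNIV. Poly_Mapping.lookup (u + w) j * coord j b))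
    = (\<Sum>b\<in>W. Poly_Mapping.single (edge b) (\<Sum>j\<in>UNIV. Poly_Mapping.lookup u j * coord j b))
    + (\<Sum>b\<in>W. Poly_Mapping.single (edge b) (\<Sum>j\<in>UNIV. Poly_Mapping.lookup w j * coord j b))"
    by (simp add: lookup_add distrib_right sum.distrib single_add)
  ultimately show ?thesis
    unfolding corner_normal_form_def by (simp only: add_ac)
qed

lemma corner_normal_form_var:
  "corner_normal_form (Poly_Mapping.single j 1) = Poly_Mapping.single n 1 + edge_exponent j"
proof -
  have "(\<Sum>i\<in>UNIV. Poly_Mapping.lookup (Poly_Mapping.single j 1) i * g i) = g j" for g :: "'n \<Rightarrow> nat"
    by (simp add: lookup_single when_def if_distrib[of "\<lambda>x. x * _"] cong: if_cong)
  from this[of "\<lambda>_. 1"] this[of "\<lambda>i. coord i _"] show ?thesis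
    by (simp add: corner_normal_form_def edge_exponent_def)
qed

text \<open>Both sides are additive in the exponent, so the congruences for the single variables multiply.\<close>

lemma corner_reduction:
  "Poly_Mapping.single (Poly_Mapping.single n (corner_shift u) + u) 1
    - Poly_Mapping.single (corner_normal_form u) 1
    \<in> (circuit_ideal A :: ('n, 'k::field) mpolynomial set)"
proof (induction u rule: exponent_induct)
  case zero
  then show ?case
    by (simp add: corner_shift_def corner_normal_form_def is_ideal_zero circuit_ideal_is_ideal)
next
  case (add j u)
  let ?I = "circuit_ideal A :: ('n, 'k) mpolynomial set"
  let ?x = "\<lambda>u. Poly_Mapping.single u 1 :: ('n, 'k) mpolynomial"
  let ?e = "\<lambda>j. Poly_Mapping.single j (1 :: nat)"
  have I: "is_ideal ?I" by (rule circuit_ideal_is_ideal)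
  let ?a = "Poly_Mapping.single n (coord_sum j) + ?e j"
  let ?b = "?e n + edge_exponent j"
  let ?s = "Poly_Mapping.single n (corner_shift u) + u"
  let ?t = "corner_normal_form u"
  have shift: "Poly_Mapping.single n (corner_shift (?e j + u)) + (?e j + u) = ?a + ?s"
    by (simp only: corner_shift_add corner_shift_var single_add ac_simps)
  have form: "corner_normal_form (?e j + u) = ?b + ?t"
    unfolding corner_normal_form_add corner_normal_form_var ..
  have "?x (?a + ?s) - ?x (?b + ?t) = ?x ?s * (?x ?a - ?x ?b) + ?x ?b * (?x ?s - ?x ?t)"
    by (simp add: right_diff_distrib mult_single add.commute)
  also have "\<dots> \<in> ?I"
    by (intro is_ideal_add[OF I] is_ideal_mult[OF I] add corner_binomial_in_circuit_ideal)
  finally show ?case unfolding shift form .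
qed

text \<open>Both quantities depend only on the total degree and the coordinate sums of the exponent, which are
  linear functions of its multidegree.\<close>

lemma corner_reduction_cong:
  assumes "multidegree A u = multidegree A w"
  shows "corner_shift u = corner_shift w" "corner_normal_form u = corner_normal_form w"
proof -
  have ker: "(\<chi> j. int (Poly_Mapping.lookup u j) - int (Poly_Mapping.lookup w j)) \<in> kernel_lattice A"
    using assms by (simp add: multidegree_eq_iff)
  have total: "(\<Sum>j\<in>UNIV. Poly_Mapping.lookup u j) = (\<Sum>j\<in>UNIV. Poly_Mapping.lookup w j)"
    using ker by (simp add: kernel_iff sum_subtractf flip: of_nat_sum)
  have coord: "(\<Sum>j\<in>UNIV. Poly_Mapping.lookup u j * coord j b) = (\<Sum>j\<in>UNIV. Poly_Mapping.lookup w j * coord j b)"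
    if "b \<in> W" for b
  proof -
    have "int (\<Sum>j\<in>UNIV. Poly_Mapping.lookup u j * coord j b) = int (\<Sum>j\<in>UNIV. Poly_Mapping.lookup w j * coord j b)"
      using ker that by (simp add: kernel_iff sum_subtractf left_diff_distrib)
    then show ?thesis by linarith
  qed
  show "corner_normal_form u = corner_normal_form w"
    using total coord by (simp add: corner_normal_form_def)
  have "corner_shift v = (\<Sum>b\<in>W. \<Sum>j\<in>UNIV. Poly_Mapping.lookup v j * coord j b)" for v
    unfolding corner_shift_def coord_sum_def sum_distrib_left by (rule sum.swap)
  then show "corner_shift u = corner_shift w" using coord by simp
qed

text \<open>Two monomials of the same multidegree have the same reduction, so a power of \<open>x\<^sub>n\<close> carries their
  difference into the circuit ideal. The polynomial has finitely many terms, so one power serves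
  for all of them.\<close>

lemma toric_kernel_saturated:
  fixes f :: "('n, 'k::field) mpolynomial"
  assumes "push_forward (multidegree A) f = 0"
  obtains k where "Poly_Mapping.single (Poly_Mapping.single n k) 1 * f \<in> circuit_ideal A"
proof -
  let ?I = "circuit_ideal A :: ('n, 'k) mpolynomial set"
  let ?x = "\<lambda>u. Poly_Mapping.single u 1 :: ('n, 'k) mpolynomial"
  have I: "is_ideal ?I" by (rule circuit_ideal_is_ideal)
  define k where "k = (\<Sum>u\<in>Poly_Mapping.keys f. corner_shift u)"
  have "?x (Poly_Mapping.single n k) * (?x u - ?x w) \<in> ?I"
    if u: "u \<in> Poly_Mapping.keys f" and eq: "multidegree A u = multidegree A w" for u w
  proof -
    let ?s = "Poly_Mapping.single n (corner_shift u)"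
    have "(?x (?s + u) - ?x (corner_normal_form u)) - (?x (?s + w) - ?x (corner_normal_form u)) \<in> ?I"
      using is_ideal_diff[OF I corner_reduction[of u] corner_reduction[of w]]
      by (simp add: corner_reduction_cong[OF eq])
    then have "?x ?s * (?x u - ?x w) \<in> ?I"
      by (simp add: right_diff_distrib mult_single)
    then have *: "?x (Poly_Mapping.single n (k - corner_shift u)) * (?x ?s * (?x u - ?x w)) \<in> ?I"
      using I by (simp add: is_ideal_iff)
    have "corner_shift u \<le> k"
      unfolding k_def by (intro member_le_sum u) auto
    then have "Poly_Mapping.single n k = Poly_Mapping.single n (k - corner_shift u) + ?s"
      by (simp flip: single_add)
    then have "?x (Poly_Mapping.single n k) = ?x (Poly_Mapping.single n (k - corner_shift u)) * ?x ?s"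
      by (simp add: mult_single)
    then show ?thesis using * by (simp add: mult.assoc)
  qed
  then show thesis
    by (intro that[of k] push_forward_eq_0_imp_multiple_in_ideal[OF I assms])
qed

text \<open>If the prime were \<open>(I\<^sub>C : f)\<close>, then an edge variable, which it contains, would put \<open>f\<close> into the
  kernel of the multigrading map, and saturation would put a power of \<open>x\<^sub>n\<close> into the prime.\<close>

lemma corner_prime_not_associated:
  "\<not> associated_prime (monomial_prime {n} :: ('n, 'k::field) mpolynomial set) (circuit_ideal A)"
proof
  assume "associated_prime (monomial_prime {n} :: ('n, 'k) mpolynomial set) (circuit_ideal A)"
  then obtain f where f: "(monomial_prime {n} :: ('n, 'k) mpolynomial set) = colon (circuit_ideal A) f"
    by (auto simp: associated_prime_def)
  obtain b where b: "b \<in> W" using W_nonempty by blast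
  have "(var (edge b) :: ('n, 'k) mpolynomial) \<in> monomial_prime {n}"
    using edge_neq_corner[OF b] by (simp add: var_in_monomial_prime)
  then have "var (edge b) * f \<in> toric_ideal A"
    using circuit_ideal_subset_toric_ideal f by (auto simp: colon_def)
  then obtain k where "Poly_Mapping.single (Poly_Mapping.single n k) 1 * f \<in> circuit_ideal A"
    using toric_kernel_saturated toric_ideal_monomial_cancel by metis
  then have "(Poly_Mapping.single (Poly_Mapping.single n k) 1 :: ('n, 'k) mpolynomial) \<in> monomial_prime {n}"
    using f by (simp add: colon_def)
  then obtain j where "j \<noteq> n" "Poly_Mapping.lookup (Poly_Mapping.single n k) j \<noteq> 0"
    unfolding monomial_prime_iff by auto
  then show False by (simp add: lookup_single_not_eq)
qed

text \<open>This is where the vertex property enters the algebra: if all entries away from \<open>n\<close> were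
  nonpositive, each coordinate equation would be a vanishing sum of terms of the same sign.\<close>

lemma kernel_positive_entry:
  assumes u: "u \<in> kernel_lattice A" "u \<noteq> 0"
  shows "\<exists>j. j \<noteq> n \<and> u $ j > 0"
proof (rule ccontr)
  assume none: "\<not> (\<exists>j. j \<noteq> n \<and> u $ j > 0)"
  have neg: "u $ j \<le> 0" if "j \<noteq> n" for j
    using none that by (auto simp: not_less)
  have "u $ j = 0" if j: "j \<noteq> n" for j
  proof -
    obtain b where b: "b \<in> W" "coord j b \<noteq> 0" using coord_nonzero[OF j] by blast
    have nonneg: "0 \<le> - (u $ i) * int (coord i b)" for i
    proof (cases "i = n")
      case False
      with neg[of i] show ?thesis by (intro mult_nonneg_nonneg) auto
    qed (simp add: coord_corner[OF b(1)])
    have "(\<Sum>i\<in>UNIV. - (u $ i) * int (coord i b)) = 0"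
      using u(1) b(1) by (simp add: kernel_iff sum_negf)
    then have "- (u $ j) * int (coord j b) = 0"
      using nonneg sum_nonneg_eq_0_iff[of UNIV "\<lambda>i. - (u $ i) * int (coord i b)"] by simp
    then show ?thesis using b by simp
  qed
  then have "u = 0" by (intro kernel_supported_on_corner_eq_0[OF u(1)]) auto
  then show False using u(2) by simp
qed

lemma toric_ideal_subset_corner_prime:
  "(toric_ideal A :: ('n, 'k::field) mpolynomial set) \<subseteq> monomial_prime {n}"
  unfolding toric_ideal_def
proof (rule ideal_gen_minimal)
  show I: "is_ideal (monomial_prime {n} :: ('n, 'k) mpolynomial set)"
    by (rule monomial_prime_is_ideal)
  show "lattice_binomial ` kernel_lattice A \<subseteq> (monomial_prime {n} :: ('n, 'k) mpolynomial set)"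
  proof clarify
    fix u assume u: "u \<in> kernel_lattice A"
    show "lattice_binomial u \<in> (monomial_prime {n} :: ('n, 'k) mpolynomial set)"
    proof (cases "u = 0")
      case True
      then show ?thesis using I by (simp add: lattice_binomial_def is_ideal_iff)
    next
      case False
      have neg: "- u \<in> kernel_lattice A" using u by (simp add: kernel_iff sum_negf)
      obtain i where i: "i \<noteq> n" "u $ i > 0"
        using kernel_positive_entry[OF u False] by blast
      obtain j where j: "j \<noteq> n" "(- u) $ j > 0"
        using kernel_positive_entry[OF neg] False by auto
      show ?thesis unfolding lattice_binomial_def
      proof (rule is_ideal_diff[OF I])
        show "monomial (\<lambda>i. nat (u $ i)) \<in> (monomial_prime {n} :: ('n, 'k) mpolynomial set)"
          using i by (intro monomial_in_monomial_prime[of i]) simp_all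
        show "monomial (\<lambda>i. nat (- u $ i)) \<in> (monomial_prime {n} :: ('n, 'k) mpolynomial set)"
          using j by (intro monomial_in_monomial_prime[of j]) simp_all
      qed
    qed
  qed
qed

end

section \<open>Normal cones of smooth vertices\<close>

lemma inner_of_int_vec:
  "of_int_vec a \<bullet> of_int_vec b = of_int (\<Sum>i\<in>UNIV. a $ i * b $ i)"
  by (simp add: inner_vec_def of_int_vec_def)

text \<open>The dual basis consists of the coefficients that express the unit vectors through \<open>W\<close>. Pairing with it
  computes the coordinates of an integer vector with respect to \<open>W\<close>, hence duality follows from
  independence. Finiteness of \<open>W\<close> comes for free, since finitely many elements of \<open>W\<close> already span.\<close>

lemma int_basis_dual:
  fixes W :: "(int ^ 'm) set"
  assumes "int_basis W"
  obtains e :: "int ^ 'm \<Rightarrow> int ^ 'm" where "finite W"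
    "\<And>b b'. b \<in> W \<Longrightarrow> b' \<in> W \<Longrightarrow>
      of_int_vec b \<bullet> of_int_vec (e b') = (if b = b' then 1 else 0)"
    "\<And>y. (\<Sum>b\<in>W. (of_int_vec b \<bullet> y) *\<^sub>R of_int_vec (e b)) = y"
proof -
  interpret module "(*s) :: int \<Rightarrow> int ^ 'm \<Rightarrow> int ^ 'm"
    by (rule module_int_vec)
  have ind: "independent W" and sp: "span W = UNIV"
    using assms by (auto simp: int_basis_def int_span_def)
  have "\<exists>t r. finite t \<and> t \<subseteq> W \<and> axis k 1 = (\<Sum>b\<in>t. r b *s b)" for k :: 'm
  proof -
    have "axis k 1 \<in> span W" using sp by simp
    then show ?thesis unfolding span_explicit by blast
  qed
  then obtain t r where tr: "\<And>k. finite (t k)" "\<And>k. t k \<subseteq> W"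
    "\<And>k. axis k 1 = (\<Sum>b\<in>t k. r k b *s b)"
    by metis
  \<comment> \<open>Finitely many elements of \<open>W\<close> suffice for all unit vectors; at the end \<open>T\<close> is all of \<open>W\<close>.\<close>
  define T where "T = (\<Union>k. t k)"
  define e :: "int ^ 'm \<Rightarrow> int ^ 'm" where "e b = (\<chi> k. if b \<in> t k then r k b else 0)" for b
  have finT: "finite T" and TW: "T \<subseteq> W" using tr(1,2) by (auto simp: T_def)
  have unit: "axis k 1 = (\<Sum>b\<in>T. e b $ k *s b)" for k
    unfolding tr(3)[of k] by (intro sum.mono_neutral_cong_left finT) (auto simp: T_def e_def)
  have expand: "z = (\<Sum>b\<in>T. (\<Sum>i\<in>UNIV. z $ i * e b $ i) *s b)" for z :: "int ^ 'm"
  proof -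
    have "z = (\<Sum>i\<in>UNIV. z $ i *s axis i 1)"
      by (rule basis_expansion[symmetric])
    also have "\<dots> = (\<Sum>i\<in>UNIV. \<Sum>b\<in>T. (z $ i * e b $ i) *s b)"
      by (simp add: unit scale_sum_right)
    also have "\<dots> = (\<Sum>b\<in>T. (\<Sum>i\<in>UNIV. z $ i * e b $ i) *s b)"
      by (subst sum.swap) (simp add: scale_sum_left)
    finally show ?thesis .
  qed
  have dual: "(\<Sum>i\<in>UNIV. b $ i * e b' $ i) = (if b = b' then 1 else 0)" 
    if b: "b \<in> W" and b': "b' \<in> insert b T" for b b'
  proof -
    \<comment> \<open>The coefficients of the expansion of \<open>b\<close> over \<open>T\<close>, minus those of the trivial expansion
      \<open>b = b\<close>; the set \<open>T\<close> is not yet known to contain \<open>b\<close>.\<close>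
    define u where "u c = (if c \<in> T then (\<Sum>i\<in>UNIV. b $ i * e c $ i) else 0) - (if c = b then 1 else 0)" for c
    have "(\<Sum>c\<in>insert b T. u c *s c) = 
       (\<Sum>c\<in>insert b T. (if c \<in> T then (\<Sum>i\<in>UNIV. b $ i * e c $ i) else 0) *s c)
        - (\<Sum>c\<in>insert b T. (if c = b then 1 else 0) *s c)"
      by (simp only: u_def scale_left_diff_distrib sum_subtractf)
    also have "(\<Sum>c\<in>insert b T. (if c \<in> T then (\<Sum>i\<in>UNIV. b $ i * e c $ i) else 0) *s c) = b"
      by (subst (2) expand[of b], rule sum.mono_neutral_cong_right) (use finT in auto)
    also have "(\<Sum>c\<in>insert b T. (if c = b then 1 else 0) *s c) = (\<Sum>c\<in>insert b T. (if c = b then b else 0))"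
      by (intro sum.cong) auto
    also have "\<dots> = b" using finT by simp
    finally have "(\<Sum>c\<in>insert b T. u c *s c) = 0" by simp
    then have "u c = 0" if "c \<in> insert b T" for c
      using independentD[OF ind, of "insert b T" u c] finT TW b that by auto
    then have "u b = 0" "u b' = 0" using b' by auto
    then show ?thesis using b' by (auto simp: u_def split: if_splits)
  qed
  have "e b = 0" if "b \<notin> T" for b
    using that by (auto simp: e_def T_def vec_eq_iff)
  then have "W \<subseteq> T"
    using dual by fastforce
  then have WT: "W = T" using TW by blast
  show thesis
  proof
    show "finite W" using WT finT by simp
    show "of_int_vec b \<bullet> of_int_vec (e b') = (if b = b' then 1 else 0)" 
      if "b \<in> W" "b' \<in> W" for b b'
      using dual[of b b'] that WT by (simp add: inner_of_int_vec)
    have entry: "(\<Sum>b\<in>W. real_of_int (b $ i) * of_int (e b $ k)) = (if i = k then 1 else 0)" for i k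
    proof -
      have "(\<Sum>b\<in>W. b $ i * e b $ k) = axis k 1 $ i"
        unfolding unit WT by (simp add: mult.commute)
      then have "(\<Sum>b\<in>W. b $ i * e b $ k) = (if i = k then 1 else 0)"
        by (simp add: axis_def)
      from arg_cong[OF this, of real_of_int] show ?thesis by (simp split: if_splits)
    qed
    show "(\<Sum>b\<in>W. (of_int_vec b \<bullet> y) *\<^sub>R of_int_vec (e b)) = y" for y :: "real ^ 'm"
    proof (rule vec_eq_iff[THEN iffD2, rule_format])
      fix k
      have "(\<Sum>b\<in>W. (of_int_vec b \<bullet> y) *\<^sub>R of_int_vec (e b)) $ k
        = (\<Sum>b\<in>W. \<Sum>i\<in>UNIV. y $ i * (of_int (b $ i) * of_int (e b $ k)))"
        by (simp add: inner_vec_def of_int_vec_def sum_distrib_left sum_distrib_right algebra_simps)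
      also have "\<dots> = (\<Sum>i\<in>UNIV. y $ i * (\<Sum>b\<in>W. of_int (b $ i) * of_int (e b $ k)))"
        by (subst sum.swap) (simp add: sum_distrib_left)
      also have "\<dots> = (\<Sum>i\<in>UNIV. if i = k then y $ i else 0)"
        unfolding entry by (intro sum.cong) auto
      also have "\<dots> = y $ k" by simp
      finally show "(\<Sum>b\<in>W. (of_int_vec b \<bullet> y) *\<^sub>R of_int_vec (e b)) $ k = y $ k" .
    qed
  qed
qed

lemma inner_normal_cone_convex_hull:
  "c \<in> inner_normal_cone (convex hull S) v \<longleftrightarrow> (\<forall>w\<in>S. c \<bullet> v \<le> c \<bullet> w)"
proof
  assume "c \<in> inner_normal_cone (convex hull S) v"
  then show "\<forall>w\<in>S. c \<bullet> v \<le> c \<bullet> w"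
    using hull_subset[of S convex] by (auto simp: inner_normal_cone_def)
next
  assume "\<forall>w\<in>S. c \<bullet> v \<le> c \<bullet> w"
  then have "convex hull S \<subseteq> {y. c \<bullet> y \<ge> c \<bullet> v}"
    by (intro hull_minimal convex_halfspace_ge) auto
  then show "c \<in> inner_normal_cone (convex hull S) v"
    by (auto simp: inner_normal_cone_def)
qed

text \<open>Removing an extreme point from a convex set leaves it convex, so the point lies outside the hull of
  the remaining generators and can be separated from it strictly.\<close>

lemma extreme_point_strict_functional:
  fixes v :: "'a::euclidean_space"
  assumes "finite S" "v extreme_point_of (convex hull S)"
  obtains c where "\<And>w. w \<in> S \<Longrightarrow> w \<noteq> v \<Longrightarrow> c \<bullet> v < c \<bullet> w"
proof -
  have "convex (convex hull S - {v})"
    using assms(2) extreme_point_of_stillconvex[of "convex hull S" v] by simp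
  then have "convex hull (S - {v}) \<subseteq> convex hull S - {v}"
    by (intro hull_minimal) (use hull_subset[of S convex] in auto)
  then have "v \<notin> convex hull (S - {v})" by auto
  moreover have "closed (convex hull (S - {v}))"
    by (intro compact_imp_closed compact_convex_hull finite_imp_compact) (use assms in auto)
  ultimately obtain a b where "a \<bullet> v < b" "\<forall>x\<in>convex hull (S - {v}). b < a \<bullet> x"
    using separating_hyperplane_closed_point[OF convex_convex_hull] by metis
  then show thesis
    by (intro that[of a]) (meson Diff_iff hull_inc less_trans singletonD)
qed

text \<open>Smoothness only provides part of a lattice basis, but the normal cone of a vertex is
  full-dimensional: a strictly separating functional can be perturbed along any \<open>b \<in> W\<close> in both
  directions without leaving the cone. If \<open>b\<close> were missing among the generators, then the dual
  vector of \<open>b\<close> would vanish on the cone, hence on both perturbations and on their difference, a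
  nonzero multiple of \<open>b\<close>.\<close>

lemma smooth_vertex_normal_cone:
  fixes v :: "real ^ 'm"
  assumes "lattice_polytope Q" "smooth_vertex Q v"
  obtains W where "int_basis W" "inner_normal_cone Q v = convex_cone hull (of_int_vec ` W)"
proof -
  obtain V where V: "finite V" "Q = convex hull (of_int_vec ` V)"
    using assms(1) by (auto simp: lattice_polytope_def)
  define S where "S = (of_int_vec ` V :: (real^'m) set)"
  have ext: "v extreme_point_of convex hull S"
    using assms(2) V by (simp add: smooth_vertex_def S_def)
  have finS: "finite S" using V by (simp add: S_def)
  obtain W B where WB: "int_basis W" "B \<subseteq> W"
    "inner_normal_cone Q v = convex_cone hull (of_int_vec ` B)"
    using assms(2) by (auto simp: smooth_vertex_def smooth_cone_def)
  obtain e where e: "\<And>b b'. b \<in> W \<Longrightarrow> b' \<in> W \<Longrightarrow>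
      of_int_vec b \<bullet> of_int_vec (e b') = (if b = b' then 1 else (0::real))"
    using int_basis_dual[OF WB(1)] by metis
  obtain c where c: "\<And>w. w \<in> S \<Longrightarrow> w \<noteq> v \<Longrightarrow> c \<bullet> v < c \<bullet> w"
    using extreme_point_strict_functional[OF finS ext] by blast
  have "b \<in> B" if b: "b \<in> W" for b
  proof (rule ccontr)
    assume nb: "b \<notin> B"
    have zero: "x \<bullet> of_int_vec (e b) = 0" if "x \<in> inner_normal_cone Q v" for x
    proof -
      have "convex_cone {x. x \<bullet> of_int_vec (e b) = (0::real)}"
        by (auto simp: convex_cone_iff inner_add_left)
      then have "convex_cone hull (of_int_vec ` B) \<subseteq> {x. x \<bullet> of_int_vec (e b) = 0}"
        by (intro hull_minimal) (use e b nb WB(2) in fastforce)+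
      then show ?thesis using that WB(3) by auto
    qed
    \<comment> \<open>Instead of perturbing \<open>c\<close> by a small multiple of \<open>b\<close>, scale it by \<open>N\<close> and perturb by \<open>b\<close>.\<close>
    define N where "N = (\<Sum>w\<in>S. \<bar>of_int_vec b \<bullet> (w - v)\<bar> / (c \<bullet> (w - v)))"
    have bound: "\<bar>of_int_vec b \<bullet> (w - v)\<bar> \<le> N * (c \<bullet> (w - v))" if w: "w \<in> S" for w
    proof (cases "w = v")
      case False
      then have pos: "0 < c \<bullet> (w - v)" using c[OF w] by (simp add: inner_diff_right)
      have "0 \<le> c \<bullet> (w' - v)" if "w' \<in> S" for w'
        using c[OF that] by (cases "w' = v") (auto simp: inner_diff_right)
      then have "\<bar>of_int_vec b \<bullet> (w - v)\<bar> / (c \<bullet> (w - v)) \<le> N"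
        unfolding N_def by (intro member_le_sum finS w) simp
      then show ?thesis using pos by (simp add: field_simps)
    qed simp
    have "N *\<^sub>R c + s *\<^sub>R of_int_vec b \<in> inner_normal_cone Q v" if "\<bar>s\<bar> = 1" for s
    proof -
      have "(N *\<^sub>R c + s *\<^sub>R of_int_vec b) \<bullet> v \<le> (N *\<^sub>R c + s *\<^sub>R of_int_vec b) \<bullet> w" if "w \<in> S" for w
      proof -
        have "s = 1 \<or> s = -1" using \<open>\<bar>s\<bar> = 1\<close> by linarith
        with bound[OF that] show ?thesis
          by (auto simp: inner_diff_right inner_add_left algebra_simps)
      qed
      then show ?thesis using V inner_normal_cone_convex_hull[of _ S v] by (simp add: S_def)
    qed
    from zero[OF this[of 1]] zero[OF this[of "-1"]] show False
      using e[OF b b] by (simp add: inner_add_left inner_diff_left)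
  qed
  then have "B = W" using WB(2) by blast
  then show thesis using that WB by blast
qed

text \<open>If the point were missing, no lattice generator of the polytope would lie on the ray from \<open>v\<close> in the
  direction \<open>e b\<close>: it would be at integral distance at least one, and convexity would yield the
  point at distance one. Then every generator other than \<open>v\<close> has a coordinate \<open>b' \<noteq> b\<close>
  that is at least one, so for large \<open>N\<close> the functional \<open>N \<cdot> \<Sum>\<^bsub>b' \<noteq> b\<^esub> b' - b\<close> is in the normal
  cone, contradicting its negative coefficient at \<open>b\<close>.\<close>

lemma smooth_vertex_edge_point:
  fixes v :: "real ^ 'm"
  assumes poly: "lattice_polytope Q" and v: "v = of_int_vec p" "v \<in> Q"
    and cone: "inner_normal_cone Q v = convex_cone hull (of_int_vec ` W)"
    and fin: "finite W"
    and dual: "\<And>b b'. b \<in> W \<Longrightarrow> b' \<in> W \<Longrightarrow>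
      of_int_vec b \<bullet> of_int_vec (e b') = (if b = b' then 1 else (0::real))"
    and expand: "\<And>y. (\<Sum>b\<in>W. (of_int_vec b \<bullet> y) *\<^sub>R of_int_vec (e b)) = y"
    and b: "b \<in> W"
  shows "v + of_int_vec (e b) \<in> Q"
proof (rule ccontr)
  assume notin: "v + of_int_vec (e b) \<notin> Q"
  obtain V where V: "finite V" "Q = convex hull (of_int_vec ` V)"
    using poly by (auto simp: lattice_polytope_def)
  have VQ: "of_int_vec w \<in> Q" if "w \<in> V" for w
    using that V(2) by (simp add: hull_inc)
  define N :: real where "N = (\<Sum>w\<in>V. \<bar>of_int_vec b \<bullet> (of_int_vec w - v)\<bar>)"
  define c where "c = N *\<^sub>R (\<Sum>b'\<in>W - {b}. of_int_vec b') - of_int_vec b"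
  have c_inner: "c \<bullet> y = N * (\<Sum>b'\<in>W - {b}. of_int_vec b' \<bullet> y) - of_int_vec b \<bullet> y" for y
    by (simp add: c_def inner_diff_left inner_sum_left)
  have N0: "N \<ge> 0" by (simp add: N_def sum_nonneg)
  have "c \<in> inner_normal_cone Q v"
    unfolding V(2) inner_normal_cone_convex_hull
  proof (intro ballI, elim imageE)
    fix x w assume w: "x = of_int_vec w" "w \<in> V"
    define t :: "int ^ 'm \<Rightarrow> real" where "t b' = of_int_vec b' \<bullet> (x - v)" for b'
    have nonneg: "t b' \<ge> 0" if "b' \<in> W" for b'
    proof -
      have "of_int_vec b' \<in> inner_normal_cone Q v" using that cone by (simp add: hull_inc)
      then show ?thesis using VQ[OF w(2)] w(1)
        by (simp add: inner_normal_cone_def t_def inner_diff_right)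
    qed
    have integral: "t b' \<in> \<int>" for b'
      unfolding t_def v(1) w(1) inner_diff_right inner_of_int_vec by (intro Ints_diff Ints_of_int)
    have tb: "t b \<le> N"
    proof -
      have "t b \<le> \<bar>of_int_vec b \<bullet> (of_int_vec w - v)\<bar>" by (simp add: t_def w(1))
      also have "\<dots> \<le> N" unfolding N_def by (intro member_le_sum V(1) w(2)) auto
      finally show ?thesis .
    qed
    have "c \<bullet> (x - v) \<ge> 0"
    proof (cases "\<exists>b'\<in>W - {b}. t b' \<noteq> 0")
      case True
      then obtain b' where b': "b' \<in> W - {b}" "t b' \<noteq> 0" by blast
      then have "1 \<le> t b'"
        using nonneg[of b'] integral[of b'] Ints_nonzero_abs_ge1[of "t b'"] by auto
      also have "\<dots> \<le> (\<Sum>b'\<in>W - {b}. t b')"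
        by (intro member_le_sum) (use b' nonneg fin in auto)
      finally have "N \<le> N * (\<Sum>b'\<in>W - {b}. t b')"
        using N0 by (simp add: mult_le_cancel_left1)
      then show ?thesis using tb by (simp add: c_inner t_def)
    next
      case False
      then have zero: "t b' = 0" if "b' \<in> W - {b}" for b' using that by blast
      have dir: "x - v = t b *\<^sub>R of_int_vec (e b)"
      proof -
        have "x - v = (\<Sum>b'\<in>W. t b' *\<^sub>R of_int_vec (e b'))"
          unfolding t_def by (rule expand[symmetric])
        also have "\<dots> = t b *\<^sub>R of_int_vec (e b)"
          using zero by (subst sum.remove[OF fin b]) (simp add: sum.neutral)
        finally show ?thesis .
      qed
      have "t b = 0"
      proof (rule ccontr)
        assume "t b \<noteq> 0"
        then have t1: "1 \<le> t b"
          using nonneg[OF b] integral[of b] Ints_nonzero_abs_ge1[of "t b"] by auto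
        have "of_int_vec (e b) = (1 / t b) *\<^sub>R (x - v)"
          using t1 dir by simp
        then have "v + of_int_vec (e b) = (1 - 1 / t b) *\<^sub>R v + (1 / t b) *\<^sub>R x"
          by (simp add: algebra_simps)
        also have "\<dots> \<in> Q"
          using t1 v(2) VQ[OF w(2)] w(1) V(2) convex_convex_hull
          by (intro convexD) auto
        finally show False using notin by blast
      qed
      then have "x - v = 0" using dir by simp
      then show ?thesis by simp
    qed
    then show "c \<bullet> v \<le> c \<bullet> x" by (simp add: inner_diff_right)
  qed
  then have "c \<in> convex_cone hull (of_int_vec ` W)" using cone by simp
  also have "\<dots> \<subseteq> {y. of_int_vec (e b) \<bullet> y \<ge> 0}"
    by (intro hull_minimal convex_cone_halfspace_ge)
      (auto simp: inner_commute[of "of_int_vec (e b)"] dual b)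
  finally have "0 \<le> c \<bullet> of_int_vec (e b)" by (simp add: inner_commute)
  moreover have "(\<Sum>b'\<in>W - {b}. of_int_vec b' \<bullet> of_int_vec (e b)) = (0::real)"
    using dual b by (intro sum.neutral) auto
  then have "c \<bullet> of_int_vec (e b) = -1"
    using dual[OF b b] by (simp add: c_inner)
  ultimately show False by simp
qed

section \<open>The corner at a smooth vertex\<close>

lemma inj_at_height_one: "inj at_height_one"
  by (auto simp: inj_def at_height_one_def vec_eq_iff split: option.splits)

lemma of_int_vec_at_height_one: "of_int_vec (at_height_one q) = at_height_one (of_int_vec q)"
  by (simp add: vec_eq_iff of_int_vec_def at_height_one_def split: option.splits)

text \<open>The coordinates are the pairings of the generators of the normal cone with \<open>a\<^sub>j - a\<^sub>n\<close>. They are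
  nonnegative because the generators attain their minimum at the vertex, they are faithful because
  \<open>W\<close> is a basis, and the unit vectors occur because all lattice points of the polytope are columns.\<close>

lemma smooth_vertex_unimodular_corner:
  fixes A :: "int ^ 'n::finite ^ ('m::finite option)"
  assumes distinct: "inj (\<lambda>j. column j A)"
    and first_row: "\<forall>j. A $ None $ j = 1"
    and points: "columns A = {z. of_int_vec z \<in> at_height_one ` Q}"
    and poly: "lattice_polytope Q"
    and vertex: "of_int_vec (column n A) = at_height_one v"
    and smooth: "smooth_vertex Q v"
  shows "\<exists>(W :: (int ^ 'm) set) edge coord. unimodular_corner A n W edge coord"
proof -
  define p where "p j = (\<chi> k. A $ Some k $ j)" for j
  define dot where "dot b z = (\<Sum>i\<in>UNIV. b $ i * z $ i)" for b z :: "int ^ 'm"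
  have column: "column j A = at_height_one (p j)" for j
    using first_row by (simp add: vec_eq_iff column_def at_height_one_def p_def split: option.splits)
  have v: "v = of_int_vec (p n)"
    using vertex inj_at_height_one unfolding column of_int_vec_at_height_one
    by (metis injD)
  have in_Q: "of_int_vec (p j) \<in> Q" for j
  proof -
    have "column j A \<in> columns A" by (auto simp: columns_def)
    then have "at_height_one (of_int_vec (p j)) \<in> at_height_one ` Q"
      by (simp add: points column of_int_vec_at_height_one)
    then show ?thesis by (simp add: inj_image_mem_iff[OF inj_at_height_one])
  qed
  have from_Q: "\<exists>j. p j = q" if "of_int_vec q \<in> Q" for q
  proof -
    have "at_height_one q \<in> columns A"
      using that by (simp add: points of_int_vec_at_height_one)
    then obtain j where "at_height_one q = column j A" by (auto simp: columns_def)
    then show ?thesis unfolding column using inj_at_height_one by (metis injD)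
  qed
  obtain W where W: "int_basis W" "inner_normal_cone Q v = convex_cone hull (of_int_vec ` W)"
    using smooth_vertex_normal_cone[OF poly smooth] by blast
  obtain e where fin: "finite W"
    and dual: "\<And>b b'. b \<in> W \<Longrightarrow> b' \<in> W \<Longrightarrow>
      of_int_vec b \<bullet> of_int_vec (e b') = (if b = b' then 1 else (0::real))"
    and expand: "\<And>y. (\<Sum>b\<in>W. (of_int_vec b \<bullet> y) *\<^sub>R of_int_vec (e b)) = y"
    using int_basis_dual[OF W(1)] by blast
  have dot_eq: "of_int_vec b \<bullet> of_int_vec z = (of_int (dot b z) :: real)" for b z :: "int ^ 'm"
    by (simp add: inner_of_int_vec dot_def)
  have dot_dual: "dot b (e b') = (if b = b' then 1 else 0)" if "b \<in> W" "b' \<in> W" for b b'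
    using dual[OF that] unfolding dot_eq by (simp split: if_splits)
  have dot_diff: "dot b (z - z') = dot b z - dot b z'" for b z z'
    by (simp add: dot_def algebra_simps sum_subtractf)
  have dot_zero: "z = 0" if "\<forall>b\<in>W. dot b z = 0" for z
  proof -
    have "of_int_vec z = (0 :: real ^ 'm)"
      using expand[of "of_int_vec z"] that by (simp add: dot_eq)
    then show ?thesis by (simp add: of_int_vec_def vec_eq_iff)
  qed
  have nonneg: "dot b (p j - p n) \<ge> 0" if b: "b \<in> W" for b j
  proof -
    have "of_int_vec b \<in> inner_normal_cone Q v" using b W(2) by (simp add: hull_inc)
    then have "of_int_vec b \<bullet> v \<le> of_int_vec b \<bullet> of_int_vec (p j)"
      using in_Q by (simp add: inner_normal_cone_def)
    then show ?thesis by (simp add: v dot_eq dot_diff)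
  qed
  have "v \<in> Q" using smooth by (simp add: smooth_vertex_def extreme_point_of_def)
  have "\<exists>j. p j = p n + e b" if "b \<in> W" for b
  proof (rule from_Q)
    have "of_int_vec (p n + e b) = v + of_int_vec (e b)"
      by (simp add: v of_int_vec_def vec_eq_iff)
    then show "of_int_vec (p n + e b) \<in> Q"
      using smooth_vertex_edge_point[OF poly v \<open>v \<in> Q\<close> W(2) fin dual expand that] by simp
  qed
  then obtain edge where edge: "\<And>b. b \<in> W \<Longrightarrow> p (edge b) = p n + e b" by metis
  define coord where "coord j b = nat (dot b (p j - p n))" for j b
  have coord: "int (coord j b) = dot b (p j - p n)" if "b \<in> W" for j b
    using nonneg[OF that] by (simp add: coord_def)
  have "unimodular_corner A n W edge coord"
  proof
    show "finite W" by (rule fin)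
    show "W \<noteq> {}"
    proof
      assume "W = {}"
      then have "(1 :: real ^ 'm) = 0" using expand[of 1] by simp
      then show False by simp
    qed
    show "coord n b = 0" for b by (simp add: coord_def dot_def)
    show "coord (edge b) b' = (if b = b' then 1 else 0)" if "b \<in> W" "b' \<in> W" for b b'
      using that by (simp add: coord_def edge dot_dual)
    show "\<exists>b\<in>W. coord j b \<noteq> 0" if j: "j \<noteq> n" for j
    proof (rule ccontr)
      assume "\<not> (\<exists>b\<in>W. coord j b \<noteq> 0)"
      then have "\<forall>b\<in>W. dot b (p j - p n) = 0" using coord by (metis of_nat_0)
      then have "p j = p n" using dot_zero by fastforce
      then have "column j A = column n A" by (simp add: column)
      then show False using distinct j by (metis injD)
    qed
    show "u \<in> kernel_lattice A \<longleftrightarrow> (\<Sum>j\<in>UNIV. u $ j) = 0 \<and>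
        (\<forall>b\<in>W. (\<Sum>j\<in>UNIV. u $ j * int (coord j b)) = 0)" for u
    proof -
      \<comment> \<open>The rows of \<open>A *v u\<close> below the first one.\<close>
      define z where "z = (\<chi> k. \<Sum>j\<in>UNIV. u $ j * p j $ k)"
      have dot_z: "(\<Sum>j\<in>UNIV. u $ j * int (coord j b)) = dot b z - (\<Sum>j\<in>UNIV. u $ j) * dot b (p n)"
        if "b \<in> W" for b
      proof -
        have "dot b z = (\<Sum>j\<in>UNIV. u $ j * dot b (p j))"
          unfolding dot_def z_def vec_lambda_beta sum_distrib_left
          by (subst sum.swap) (simp add: mult.left_commute)
        then show ?thesis
          using that by (simp add: coord dot_diff right_diff_distrib sum_subtractf sum_distrib_right)
      qed
      have "u \<in> kernel_lattice A \<longleftrightarrow> (\<Sum>j\<in>UNIV. u $ j) = 0 \<and> z = 0"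
        using first_row
        by (simp add: kernel_lattice_def vec_eq_iff matrix_vector_mult_def split_option_all
            z_def p_def mult.commute)
      also have "\<dots> \<longleftrightarrow> (\<Sum>j\<in>UNIV. u $ j) = 0 \<and> (\<forall>b\<in>W. dot b z = 0)"
        using dot_zero[of z] by (auto simp: dot_def)
      finally show ?thesis using dot_z by auto
    qed
  qed
  then show ?thesis by blast
qed

theorem theorem4p15:
  fixes A :: "int ^ 'n ^ ('m::finite option)"
    and R :: "(real ^ ('m option)) set"
    and R' :: "(real ^ 'm) set"
    and n :: "'n::finite"
    and v :: "real ^ 'm"
  assumes distinct_columns: "inj (\<lambda>j. column j A)"
    and generates: "int_span (columns A) = UNIV"
    and first_row: "\<forall>j. A $ None $ j = 1"
    and polytope_R: "lattice_polytope R"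
    and lattice_points: "columns A = {z. of_int_vec z \<in> R}"
    and R_at_height_one: "R = at_height_one ` R'"
    and polytope_R': "lattice_polytope R'"
    and full_dim: "aff_dim R' = int CARD('m)"
    and vertex_eq: "of_int_vec (column n A) = at_height_one v"
    and smooth: "smooth_vertex R' v"
  shows "(monomial_prime {n} :: ('n, 'k::alg_closed_field) mpolynomial set)
            = monomial_prime {n} + toric_ideal A
       \<and> \<not> associated_prime (monomial_prime {n} :: ('n, 'k) mpolynomial set) (circuit_ideal A)"
proof -
  obtain W :: "(int ^ 'm) set" and edge coord where "unimodular_corner A n W edge coord"
    using smooth_vertex_unimodular_corner[OF distinct_columns first_row
        lattice_points[unfolded R_at_height_one] polytope_R' vertex_eq smooth]
    by blast
  then interpret unimodular_corner A n W edge coord .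
  let ?P = "monomial_prime {n} :: ('n, 'k) mpolynomial set"
  have "?P + toric_ideal A \<subseteq> ?P"
    using toric_ideal_subset_corner_prime is_ideal_add[OF monomial_prime_is_ideal]
    by (auto elim!: set_plus_elim)
  moreover have "?P \<subseteq> ?P + toric_ideal A"
    using set_plus_intro[OF _ is_ideal_zero[OF toric_ideal_is_ideal]] by fastforce
  ultimately show ?thesis using corner_prime_not_associated by blast
qed

end
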